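(* Let $R$ be a local ring with maximal ideal $\mathfrak{m}$, let $A$ be an MDG $R$-algebra, and let $X$ be an MDG $A$-module. Let $\langle X\rangle\subseteq X$ be the associator $A$-submodule of $X$. Assume that $\langle X\rangle$ is minimal, meaning $\mathrm{d}\langle X\rangle\subseteq\mathfrak{m}\langle X\rangle$, and that each homogeneous component $\langle X\rangle_{i}$ is a finitely generated $R$-module. If $X$ is associative in degree $i$ (that is, $\langle X\rangle_i=0$), then $X$ is associative in degree $i+1$ (that is, $\langle X\rangle_{i+1}=0$) if and only if $X$ is homologically associative in degree $i+1$ (that is, $\mathrm{H}_{i+1}(\langle X\rangle)=0$). In particular, if $\langle X\rangle$ is also bounded below (meaning $\langle X\rangle_{i}=0$ for $i\ll0$), then $X$ is associative if and only if $X$ is homologically associative (that is, $\mathrm{H}(\langle X\rangle)=0$).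
   Context: All rings are commutative with $1$. An $R$-complex is a $\mathbb{Z}$-graded $R$-module with an $R$-linear differential $\mathrm{d}$ of degree $-1$; $|a|$ denotes the (homological) degree of a homogeneous element $a$. An MDG $R$-algebra is an $R$-complex $A$ with a chain map $A\otimes_R A\to A$, $a_1\otimes a_2\mapsto a_1a_2$, which is unital (there is $1\in A$ with $1a=a=a1$) and strictly graded-commutative ($a_1a_2=(-1)^{|a_1||a_2|}a_2a_1$ for homogeneous $a_1,a_2$, and $a^2=0$ for $|a|$ odd). Associativity is not required. An MDG $A$-module is an $R$-complex $X$ with a chain map $A\otimes_R X\to X$, $a\otimes x\mapsto ax$, with $1x=x$; one sets $xa=(-1)^{|a||x|}ax$. It is associative if $a_1(a_2x)=(a_1a_2)x$ for all $a_1,a_2\in A$, $x\in X$. The associators of $X$ are the elements $[a_1,a_2,x]=(a_1a_2)x-a_1(a_2x)$. The associator $A$-submodule $\langle X\rangle$ is the smallest MDG $A$-submodule of $X$ (subcomplex closed under $A$-scalar multiplication) containing all associators. *)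

theory Defs
  imports "HOL.Modules"
begin

text \<open>The base ring is a type of class \<open>comm_ring_1\<close>, so that its ideals are the submodules of
  the ring over itself, and modules are those of \<open>HOL.Modules\<close>.\<close>

definition maximal_ideal :: "'r::comm_ring_1 set \<Rightarrow> bool" where
  "maximal_ideal I \<longleftrightarrow> module.subspace (*) I \<and> I \<noteq> UNIV \<and>
     (\<forall>J. module.subspace (*) J \<and> I \<subseteq> J \<longrightarrow> J = I \<or> J = UNIV)"

definition local_ring :: "'r::comm_ring_1 set \<Rightarrow> bool" where
  "local_ring m \<longleftrightarrow> maximal_ideal m \<and> (\<forall>J. maximal_ideal J \<longrightarrow> J = m)"

context module
begin

definition ideal_times :: "'a set \<Rightarrow> 'b set \<Rightarrow> 'b set" where
  "ideal_times I S = span {c *s y |c y. c \<in> I \<and> y \<in> S}"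

definition finitely_generated :: "'b set \<Rightarrow> bool" where
  "finitely_generated S \<longleftrightarrow> (\<exists>B. finite B \<and> span B = S)"

end

text \<open>The Koszul sign: \<open>sgn_pow n x\<close> is $(-1)^n x$ for an integer $n$.\<close>

definition sgn_pow :: "int \<Rightarrow> 'x::ab_group_add \<Rightarrow> 'x" where
  "sgn_pow n x = (if even n then x else - x)"

definition homogeneous_decomposition :: "(int \<Rightarrow> 'x::ab_group_add set) \<Rightarrow> 'x \<Rightarrow> (int \<Rightarrow> 'x) \<Rightarrow> bool" where
  "homogeneous_decomposition X x f \<longleftrightarrow>
     finite {i. f i \<noteq> 0} \<and> (\<forall>i. f i \<in> X i) \<and> x = (\<Sum>i | f i \<noteq> 0. f i)"

text \<open>The type \<open>'x\<close> is the whole module, the internal direct sum of the components \<open>X i\<close>.\<close>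

locale R_complex = module scale
  for scale :: "'r::comm_ring_1 \<Rightarrow> 'x::ab_group_add \<Rightarrow> 'x" +
  fixes X :: "int \<Rightarrow> 'x set"
    and d :: "'x \<Rightarrow> 'x"
  assumes subspace_component: "subspace (X i)"
    and direct_sum: "\<exists>!f. homogeneous_decomposition X x f"
    and d_linear: "module_hom scale scale d"
    and d_degree: "x \<in> X i \<Longrightarrow> d x \<in> X (i - 1)"
    and d_d: "d (d x) = 0"
begin

definition subcomplex :: "'x set \<Rightarrow> bool" where
  "subcomplex Y \<longleftrightarrow> subspace Y \<and>
     (\<forall>x\<in>Y. \<forall>f. homogeneous_decomposition X x f \<longrightarrow> (\<forall>i. f i \<in> Y)) \<and>
     d ` Y \<subseteq> Y"

definition minimal :: "'r set \<Rightarrow> 'x set \<Rightarrow> bool" where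
  "minimal m Y \<longleftrightarrow> d ` Y \<subseteq> ideal_times m Y"

text \<open>Homology of a subcomplex \<open>Y\<close>, whose component of degree \<open>i\<close> is \<open>Y \<inter> X i\<close>, as a set of cosets
  of the boundaries. The zero class is the set of boundaries itself.\<close>

definition homology :: "'x set \<Rightarrow> 'x set set" where
  "homology Y = {z \<in> Y. d z = 0} // {(u, v). u - v \<in> d ` Y}"

definition homology_deg :: "'x set \<Rightarrow> int \<Rightarrow> 'x set set" where
  "homology_deg Y i =
     {z \<in> Y \<inter> X i. d z = 0} // {(u, v). u - v \<in> d ` (Y \<inter> X (i + 1))}"

definition homology_zero :: "'x set \<Rightarrow> bool" where
  "homology_zero Y \<longleftrightarrow> homology Y = {d ` Y}"

definition homology_deg_zero :: "'x set \<Rightarrow> int \<Rightarrow> bool" where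
  "homology_deg_zero Y i \<longleftrightarrow> homology_deg Y i = {d ` (Y \<inter> X (i + 1))}"

end

text \<open>A chain map $A \otimes_R Y \to Y$ is given as the corresponding \<open>R\<close>-bilinear map: it adds degrees
  and commutes with the differentials, the differential of $a \otimes y$ being
  $\mathrm{d}a \otimes y + (-1)^{|a|} a \otimes \mathrm{d}y$.\<close>

definition chain_pairing ::
  "('r::comm_ring_1 \<Rightarrow> 'a::ab_group_add \<Rightarrow> 'a) \<Rightarrow> (int \<Rightarrow> 'a set) \<Rightarrow> ('a \<Rightarrow> 'a) \<Rightarrow>
   ('r \<Rightarrow> 'y::ab_group_add \<Rightarrow> 'y) \<Rightarrow> (int \<Rightarrow> 'y set) \<Rightarrow> ('y \<Rightarrow> 'y) \<Rightarrow>
   ('a \<Rightarrow> 'y \<Rightarrow> 'y) \<Rightarrow> bool" where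
  "chain_pairing scaleA A dA scaleY Y dY p \<longleftrightarrow>
     (\<forall>y. module_hom scaleA scaleY (\<lambda>a. p a y)) \<and>
     (\<forall>a. module_hom scaleY scaleY (p a)) \<and>
     (\<forall>i j. \<forall>a\<in>A i. \<forall>y\<in>Y j. p a y \<in> Y (i + j)) \<and>
     (\<forall>i. \<forall>a\<in>A i. \<forall>y. dY (p a y) = p (dA a) y + sgn_pow i (p a (dY y)))"

locale mdg_algebra = R_complex scaleA A dA
  for scaleA :: "'r::comm_ring_1 \<Rightarrow> 'a::ab_group_add \<Rightarrow> 'a"
    and A :: "int \<Rightarrow> 'a set"
    and dA :: "'a \<Rightarrow> 'a" +
  fixes mul :: "'a \<Rightarrow> 'a \<Rightarrow> 'a"
    and unit :: 'a
  assumes mul_chain_map: "chain_pairing scaleA A dA scaleA A dA mul"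
    and mul_unit: "mul unit a = a" "mul a unit = a"
    and graded_commutative: "a \<in> A i \<Longrightarrow> b \<in> A j \<Longrightarrow> mul a b = sgn_pow (i * j) (mul b a)"
    and odd_square: "a \<in> A i \<Longrightarrow> odd i \<Longrightarrow> mul a a = 0"

locale mdg_module = alg: mdg_algebra scaleA A dA mul unit + R_complex scale X d
  for scaleA :: "'r::comm_ring_1 \<Rightarrow> 'a::ab_group_add \<Rightarrow> 'a"
    and A :: "int \<Rightarrow> 'a set"
    and dA :: "'a \<Rightarrow> 'a"
    and mul :: "'a \<Rightarrow> 'a \<Rightarrow> 'a"
    and unit :: 'a
    and scale :: "'r \<Rightarrow> 'x::ab_group_add \<Rightarrow> 'x"
    and X :: "int \<Rightarrow> 'x set"
    and d :: "'x \<Rightarrow> 'x" +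
  fixes act :: "'a \<Rightarrow> 'x \<Rightarrow> 'x"
  assumes act_chain_map: "chain_pairing scaleA A dA scale X d act"
    and act_unit: "act unit x = x"
begin

definition associative :: bool where
  "associative \<longleftrightarrow> (\<forall>a b x. act a (act b x) = act (mul a b) x)"

definition associator :: "'a \<Rightarrow> 'a \<Rightarrow> 'x \<Rightarrow> 'x" where
  "associator a b x = act (mul a b) x - act a (act b x)"

definition mdg_submodule :: "'x set \<Rightarrow> bool" where
  "mdg_submodule Y \<longleftrightarrow> subcomplex Y \<and> (\<forall>a. \<forall>y\<in>Y. act a y \<in> Y)"

definition associator_submodule :: "'x set" where
  "associator_submodule = \<Inter> {Y. mdg_submodule Y \<and> (\<forall>a b x. associator a b x \<in> Y)}"

lemma associator_submodule_smallest:
  shows "mdg_submodule associator_submodule"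
    and "associator a b x \<in> associator_submodule"
    and "mdg_submodule Y \<Longrightarrow> (\<And>a b x. associator a b x \<in> Y) \<Longrightarrow> associator_submodule \<subseteq> Y"
proof -
  show "mdg_submodule associator_submodule"
    unfolding mdg_submodule_def subcomplex_def associator_submodule_def
    by (intro conjI subspace_Inter) blast+
qed (auto simp: associator_submodule_def)

definition associative_in_degree :: "int \<Rightarrow> bool" where
  "associative_in_degree i \<longleftrightarrow> associator_submodule \<inter> X i = {0}"

definition homologically_associative_in_degree :: "int \<Rightarrow> bool" where
  "homologically_associative_in_degree i \<longleftrightarrow> homology_deg_zero associator_submodule i"

definition homologically_associative :: bool where
  "homologically_associative \<longleftrightarrow> homology_zero associator_submodule"

end

end

theory Submission
  imports Main Defs
begin

text \<open>If the associator submodule $Y$ vanishes in degree $i$, then every element of $Y_{i+1}$ is a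
  cycle. If also $\mathrm{H}_{i+1}(Y) = 0$, then every such element is a boundary, so by minimality
  $Y_{i+1} \subseteq \mathfrak{m} Y \cap X_{i+1} = \mathfrak{m} Y_{i+1}$, and Nakayama's lemma gives
  $Y_{i+1} = 0$. In the bounded below case this is iterated upwards from a degree where $Y$
  vanishes.\<close>

section \<open>Ideals, maximal ideals and units of a local ring\<close>

lemma module_self: "module ((*) :: 'r::comm_ring_1 \<Rightarrow> 'r \<Rightarrow> 'r)"
  by unfold_locales (simp_all add: algebra_simps)

lemma ideal_iff:
  fixes I :: "'r::comm_ring_1 set"
  shows "module.subspace (*) I \<longleftrightarrow>
    0 \<in> I \<and> (\<forall>x\<in>I. \<forall>y\<in>I. x + y \<in> I) \<and> (\<forall>c. \<forall>x\<in>I. c * x \<in> I)"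
  by (rule module.subspace_def[OF module_self])

lemma ideal_eq_UNIV_iff:
  fixes I :: "'r::comm_ring_1 set"
  assumes "module.subspace (*) I"
  shows "I = UNIV \<longleftrightarrow> 1 \<in> I"
  using assms unfolding ideal_iff by (metis UNIV_I UNIV_eq_I mult.right_neutral)

text \<open>Zorn's lemma, applied to the ideals above \<open>I\<close> that avoid \<open>1\<close>.
  Expressing properness as \<open>1 \<notin> J\<close> makes it pass to unions of chains at
  once.\<close>

lemma proper_ideal_subset_maximal_ideal:
  fixes I :: "'r::comm_ring_1 set"
  assumes I: "module.subspace (*) I" "1 \<notin> I"
  obtains J where "maximal_ideal J" "I \<subseteq> J"
proof -
  let ?P = "{J. module.subspace (*) J \<and> I \<subseteq> J \<and> 1 \<notin> J}"
  have "\<exists>M\<in>?P. \<forall>J\<in>?P. M \<subseteq> J \<longrightarrow> J = M"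
  proof (rule subset_Zorn_nonempty)
    show "?P \<noteq> {}" using I by auto
  next
    fix C assume C: "C \<noteq> {}" "subset.chain ?P C"
    then have sub: "module.subspace (*) J" "I \<subseteq> J" "1 \<notin> J" if "J \<in> C" for J
      using that by (auto simp: subset_chain_def)
    have "x + y \<in> \<Union> C" if "x \<in> \<Union> C" "y \<in> \<Union> C" for x y
    proof -
      from that obtain J K where JK: "J \<in> C" "K \<in> C" "x \<in> J" "y \<in> K" by blast
      \<comment> \<open>The larger of the two chain members contains both summands, hence their
        sum.\<close>
      with C consider "J \<subseteq> K" | "K \<subseteq> J" by (auto simp: subset_chain_def)
      then show ?thesis
        using JK sub(1)[unfolded ideal_iff] by cases (meson UnionI subsetD)+
    qed
    moreover have "0 \<in> \<Union> C" "\<And>c x. x \<in> \<Union> C \<Longrightarrow> c * x \<in> \<Union> C"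
      using C(1) sub(1)[unfolded ideal_iff] by blast+
    ultimately have "module.subspace (*) (\<Union> C)" unfolding ideal_iff by blast
    then show "\<Union> C \<in> ?P" using C(1) sub(2,3) by blast
  qed
  then obtain M where MP: "M \<in> ?P" and max: "\<forall>J\<in>?P. M \<subseteq> J \<longrightarrow> J = M" ..
  from MP have M: "module.subspace (*) M" "I \<subseteq> M" "1 \<notin> M" by auto
  have "J = M \<or> J = UNIV" if J: "module.subspace (*) J" "M \<subseteq> J" for J
  proof (cases "1 \<in> J")
    case True
    then show ?thesis using ideal_eq_UNIV_iff[OF J(1)] by simp
  next
    case False
    then have "J \<in> ?P" using J M(2) by auto
    then show ?thesis using max J(2) by simp
  qed
  then have "maximal_ideal M"
    unfolding maximal_ideal_def using M(1,3) by auto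
  then show ?thesis using M(2) by (rule that)
qed

text \<open>A non-unit generates a proper principal ideal, which lies in some maximal ideal, and
  \<open>m\<close> is the only one.\<close>

lemma local_ring_unit:
  fixes m :: "'r::comm_ring_1 set"
  assumes m: "local_ring m" and u: "u \<notin> m"
  shows "u dvd 1"
proof (rule ccontr)
  assume nu: "\<not> u dvd 1"
  have "module.subspace (*) {x. u dvd x}"
    unfolding ideal_iff by (auto intro: dvd_add dvd_mult)
  with nu obtain J where "maximal_ideal J" "{x. u dvd x} \<subseteq> J"
    using proper_ideal_subset_maximal_ideal by blast
  then have "maximal_ideal J" "u \<in> J" by auto
  with m u show False unfolding local_ring_def by blast
qed

lemma local_ring_ideal: "local_ring m \<Longrightarrow> module.subspace (*) m"
  by (simp add: local_ring_def maximal_ideal_def)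

text \<open>If \<open>1 - c\<close> were in \<open>m\<close>, adding \<open>c\<close> would put
  \<open>1\<close> in \<open>m\<close>. This is the unit by which Nakayama's lemma divides.\<close>

lemma local_ring_one_minus_unit:
  fixes m :: "'r::comm_ring_1 set"
  assumes m: "local_ring m" and c: "c \<in> m"
  shows "(1 - c) dvd 1"
proof (rule local_ring_unit[OF m])
  have "1 \<notin> m"
    using m ideal_eq_UNIV_iff[of m] by (auto simp: local_ring_def maximal_ideal_def)
  moreover have "(1 - c) + c \<in> m" if "1 - c \<in> m"
    using local_ring_ideal[OF m] that c unfolding ideal_iff by blast
  ultimately show "1 - c \<notin> m" by auto
qed

section \<open>Nakayama's lemma\<close>

context module
begin

text \<open>Isolates the coefficient of one generator. Only that coefficient has to stay in
  \<open>m\<close>; the rest may be any element of \<open>span B\<close>, which is all that the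
  induction in Nakayama's lemma uses.\<close>

lemma ideal_times_span_insert:
  assumes m: "module.subspace (*) m" and x: "x \<in> ideal_times m (span (insert b B))"
  obtains c w where "c \<in> m" "w \<in> span B" "x = c *s b + w"
proof -
  note mI = m[unfolded ideal_iff]
  \<comment> \<open>The elements of the desired form make up a submodule containing all products
    that generate \<open>ideal_times m (span (insert b B))\<close>, so minimality of the span
    finishes.\<close>
  let ?S = "{c *s b + w |c w. c \<in> m \<and> w \<in> span B}"
  have "subspace ?S"
  proof (rule subspaceI)
    show "0 \<in> ?S" using mI span_zero by force
  next
    fix x y assume "x \<in> ?S" "y \<in> ?S"
    then obtain c w c' w' where "c \<in> m" "w \<in> span B" "c' \<in> m" "w' \<in> span B"
      and "x = c *s b + w" "y = c' *s b + w'" by blast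
    then have "x + y = (c + c') *s b + (w + w')" "c + c' \<in> m" "w + w' \<in> span B"
      using mI by (auto simp: scale_left_distrib span_add)
    then show "x + y \<in> ?S" by blast
  next
    fix a x assume "x \<in> ?S"
    then obtain c w where "c \<in> m" "w \<in> span B" "x = c *s b + w" by blast
    then have "a *s x = (a * c) *s b + a *s w" "a * c \<in> m" "a *s w \<in> span B"
      using mI by (auto simp: scale_right_distrib span_scale)
    then show "a *s x \<in> ?S" by blast
  qed
  moreover have "{c *s y |c y. c \<in> m \<and> y \<in> span (insert b B)} \<subseteq> ?S"
  proof clarify
    fix c y assume c: "c \<in> m" and "y \<in> span (insert b B)"
    \<comment> \<open>\<open>k\<close> is a coefficient of \<open>b\<close> in \<open>y\<close>;
      multiplying by \<open>c\<close> moves it into the ideal \<open>m\<close>.\<close>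
    then obtain k where k: "y - k *s b \<in> span B" using span_breakdown_eq by blast
    have "c *s y = (k * c) *s b + c *s (y - k *s b)"
      by (simp add: scale_right_diff_distrib mult.commute)
    then show "\<exists>c' w. c *s y = c' *s b + w \<and> c' \<in> m \<and> w \<in> span B"
      using c k mI span_scale by blast
  qed
  ultimately have "ideal_times m (span (insert b B)) \<subseteq> ?S"
    unfolding ideal_times_def by (rule span_minimal[rotated])
  with x that show ?thesis by blast
qed

text \<open>Induction on the generating set: each generator turns out to be redundant, so the span
  is that of the empty set.\<close>

lemma nakayama_span:
  assumes m: "local_ring m" and "finite B" and "span B \<subseteq> ideal_times m (span B)"
  shows "span B = {0}"
  using assms(2,3)
proof (induction B rule: finite_induct)
  case empty
  then show ?case by simp
next
  case (insert b B)
  have "b \<in> span (insert b B)" by (simp add: span_base)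
  with insert.prems obtain c w where c: "c \<in> m" and w: "w \<in> span B" and b: "b = c *s b + w"
    using ideal_times_span_insert[OF local_ring_ideal[OF m]] by blast
  \<comment> \<open>\<open>e\<close> inverts \<open>1 - c\<close>, so \<open>b = c *s b + w\<close>
    can be solved as \<open>b = e *s w\<close>.\<close>
  obtain e where e: "1 = (1 - c) * e"
    using local_ring_one_minus_unit[OF m c] by (rule dvdE)
  have "b = (e * (1 - c)) *s b" using e by (simp add: mult.commute)
  also have "\<dots> = e *s (b - c *s b)" by (metis scale_left_diff_distrib scale_one scale_scale)
  also have "\<dots> = e *s w" using b by (metis add_diff_cancel_left')
  finally have "b \<in> span B" using w span_scale by metis
  \<comment> \<open>Since the span does not change, the inclusion assumed for
    \<open>insert b B\<close> is the one that the induction hypothesis requires for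
    \<open>B\<close>.\<close>
  then have "span (insert b B) = span B" unfolding span_eq by (auto intro: span_base)
  with insert.IH insert.prems show ?case by (simp only:)
qed

lemma nakayama:
  assumes "local_ring m" "finitely_generated M" "M \<subseteq> ideal_times m M"
  shows "M = {0}"
  using assms nakayama_span unfolding finitely_generated_def by blast

end

section \<open>Homogeneous components in a complex\<close>

context R_complex
begin

definition component :: "'x \<Rightarrow> int \<Rightarrow> 'x" where
  "component x = (THE f. homogeneous_decomposition X x f)"

lemma homogeneous_decomposition_component: "homogeneous_decomposition X x (component x)"
  unfolding component_def by (rule theI'[OF direct_sum])

lemma component_unique: "homogeneous_decomposition X x f \<Longrightarrow> component x = f"
  using direct_sum homogeneous_decomposition_component by blast

lemma component_in: "component x i \<in> X i"
  using homogeneous_decomposition_component by (auto simp: homogeneous_decomposition_def)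

lemma finite_component: "finite {i. component x i \<noteq> 0}"
  using homogeneous_decomposition_component by (auto simp: homogeneous_decomposition_def)

lemma sum_component:
  assumes "finite S" "{i. component x i \<noteq> 0} \<subseteq> S"
  shows "x = (\<Sum>i\<in>S. component x i)"
proof -
  have "x = (\<Sum>i | component x i \<noteq> 0. component x i)"
    using homogeneous_decomposition_component by (auto simp: homogeneous_decomposition_def)
  also have "\<dots> = (\<Sum>i\<in>S. component x i)"
    using assms by (intro sum.mono_neutral_left) auto
  finally show ?thesis .
qed

text \<open>\<open>S\<close> may be larger than the support of \<open>f\<close>. This spares
  computing exact supports, which can shrink under addition, scaling and \<open>d\<close>.\<close>

lemma component_eqI:
  assumes "finite S" "\<And>i. f i \<in> X i" "\<And>i. i \<notin> S \<Longrightarrow> f i = 0" "x = (\<Sum>i\<in>S. f i)"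
  shows "component x = f"
proof (rule component_unique)
  have "{i. f i \<noteq> 0} \<subseteq> S" using assms(3) by blast
  then show "homogeneous_decomposition X x f"
    unfolding homogeneous_decomposition_def using assms
    by (auto intro: finite_subset sum.mono_neutral_right)
qed

lemma component_homogeneous: "x \<in> X i \<Longrightarrow> component x i = x"
  using component_eqI[of "{i}" "\<lambda>j. if j = i then x else 0" x] subspace_component subspace_0
  by auto

lemma module_hom_component: "module_hom scale scale (\<lambda>x. component x i)"
proof
  fix x y
  let ?S = "{i. component x i \<noteq> 0} \<union> {i. component y i \<noteq> 0}"
  have "x = (\<Sum>i\<in>?S. component x i)" "y = (\<Sum>i\<in>?S. component y i)"
    using finite_component by (intro sum_component; auto)+
  then have "component (x + y) = (\<lambda>i. component x i + component y i)"
    using finite_component component_in subspace_component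
    by (intro component_eqI[of ?S]) (auto simp: sum.distrib subspace_add)
  then show "component (x + y) i = component x i + component y i" by simp
next
  fix c x
  let ?S = "{i. component x i \<noteq> 0}"
  have "x = (\<Sum>i\<in>?S. component x i)"
    using finite_component by (intro sum_component) auto
  then have "scale c x = (\<Sum>i\<in>?S. scale c (component x i))" by (metis scale_sum_right)
  then have "component (scale c x) = (\<lambda>i. scale c (component x i))"
    using finite_component component_in subspace_component
    by (intro component_eqI[of ?S]) (auto simp: subspace_scale)
  then show "component (scale c x) i = scale c (component x i)" by simp
qed

text \<open>Apply \<open>d\<close> to the decomposition of \<open>x\<close>: the part of degree
  \<open>i + 1\<close> lands in degree \<open>i\<close>, and uniqueness of decompositions identifies
  it.\<close>

lemma component_d: "component (d x) i = d (component x (i + 1))"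
proof -
  interpret d: module_hom scale scale d by (rule d_linear)
  let ?S = "{i. component x i \<noteq> 0}"
  have "d x = d (\<Sum>i\<in>?S. component x i)"
    using sum_component[of ?S x] finite_component by simp
  also have "\<dots> = (\<Sum>i\<in>?S. d (component x i))" by (rule d.sum)
  \<comment> \<open>Reindexing by the target degree \<open>i = j - 1\<close> turns the sum into a
    homogeneous decomposition of \<open>d x\<close>.\<close>
  also have "\<dots> = (\<Sum>i\<in>(\<lambda>j. j - 1) ` ?S. d (component x (i + 1)))"
    by (subst sum.reindex) (auto simp: inj_on_def)
  finally have "d x = (\<Sum>i\<in>(\<lambda>j. j - 1) ` ?S. d (component x (i + 1)))" .
  moreover have "d (component x (i + 1)) \<in> X i" for i
    using d_degree[OF component_in[of x "i + 1"]] by simp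
  moreover have "d (component x (i + 1)) = 0" if "i \<notin> (\<lambda>j. j - 1) ` ?S" for i
  proof -
    have "component x (i + 1) = 0" using that by (force simp: image_iff)
    then show ?thesis by (simp add: d.zero)
  qed
  ultimately have "component (d x) = (\<lambda>i. d (component x (i + 1)))"
    using finite_component by (intro component_eqI[of "(\<lambda>j. j - 1) ` ?S"]) auto
  then show ?thesis by simp
qed

lemma subcomplex_component: "subcomplex Y \<Longrightarrow> y \<in> Y \<Longrightarrow> component y i \<in> Y"
  using homogeneous_decomposition_component unfolding subcomplex_def by blast

lemma subcomplex_eq_zero:
  assumes "subcomplex Y" "\<And>i. Y \<inter> X i = {0}"
  shows "Y = {0}"
proof -
  have "y = 0" if "y \<in> Y" for y
  proof -
    have "component y i = 0" for i
      using assms subcomplex_component[OF assms(1) that] component_in by blast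
    then show ?thesis using sum_component[of "{}" y] by simp
  qed
  moreover have "0 \<in> Y" using assms(2)[of 0] by blast
  ultimately show ?thesis by blast
qed

lemma subcomplex_zero: "subcomplex {0}"
proof -
  interpret d: module_hom scale scale d by (rule d_linear)
  have "f i = 0" if "homogeneous_decomposition X 0 f" for f i
    using component_unique[OF that] module_hom.zero[OF module_hom_component] by metis
  then show ?thesis by (simp add: subcomplex_def subspace_0 d.zero)
qed

text \<open>Projection to degree \<open>i\<close> is linear and sends a generator
  \<open>scale c y\<close> to \<open>scale c (component y i)\<close>, whose second factor stays in
  \<open>Y\<close> because \<open>Y\<close> is graded. The projection fixes
  \<open>x\<close>.\<close>

lemma ideal_times_homogeneous:
  assumes Y: "subcomplex Y" and x: "x \<in> ideal_times I Y" "x \<in> X i"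
  shows "x \<in> ideal_times I (Y \<inter> X i)"
proof -
  interpret p: module_hom scale scale "\<lambda>x. component x i" by (rule module_hom_component)
  have "component x i \<in> span ((\<lambda>x. component x i) ` {scale c y |c y. c \<in> I \<and> y \<in> Y})"
    using x(1) unfolding ideal_times_def p.span_image by blast
  also have "\<dots> \<subseteq> ideal_times I (Y \<inter> X i)"
    unfolding ideal_times_def using subcomplex_component[OF Y] component_in
    by (intro span_mono) (force simp: p.scale)
  finally show ?thesis using component_homogeneous[OF x(2)] by simp
qed

section \<open>Vanishing of homology, in all degrees and in one\<close>

lemma quotient_eq_zero_iff:
  assumes B: "subspace B" and Z: "0 \<in> Z"
  shows "Z // {(u, v). u - v \<in> B} = {B} \<longleftrightarrow> Z \<subseteq> B"
proof -
  have coset: "{(u, v). u - v \<in> B} `` {z} = B \<longleftrightarrow> z \<in> B" for z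
  proof
    assume eq: "{(u, v). u - v \<in> B} `` {z} = B"
    have "z \<in> {(u, v). u - v \<in> B} `` {z}" using subspace_0[OF B] by simp
    then show "z \<in> B" by (simp only: eq)
  next
    assume z: "z \<in> B"
    have "z - v \<in> B \<longleftrightarrow> v \<in> B" for v
      using subspace_diff[OF B z, of v] subspace_diff[OF B z, of "z - v"] by auto
    then show "{(u, v). u - v \<in> B} `` {z} = B" by auto
  qed
  \<comment> \<open>\<open>Z\<close> is nonempty, so an image in which every value is
    \<open>b\<close> is exactly \<open>{b}\<close> and not empty.\<close>
  have image: "f ` Z = {b} \<longleftrightarrow> (\<forall>z\<in>Z. f z = b)" for f and b :: "'x set"
    using Z by force
  have "Z // {(u, v). u - v \<in> B} = (\<lambda>z. {(u, v). u - v \<in> B} `` {z}) ` Z"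
    unfolding quotient_def by auto
  also have "\<dots> = {B} \<longleftrightarrow> (\<forall>z\<in>Z. {(u, v). u - v \<in> B} `` {z} = B)"
    by (rule image)
  also have "\<dots> \<longleftrightarrow> Z \<subseteq> B" unfolding coset by auto
  finally show ?thesis .
qed

lemma subspace_boundaries: "subspace S \<Longrightarrow> subspace (d ` S)"
  using module_hom.subspace_image[OF d_linear] .

lemma homology_zero_iff:
  assumes Y: "subcomplex Y"
  shows "homology_zero Y \<longleftrightarrow> {z \<in> Y. d z = 0} \<subseteq> d ` Y"
  unfolding homology_zero_def homology_def
  using Y module_hom.zero[OF d_linear]
  by (intro quotient_eq_zero_iff subspace_boundaries) (auto simp: subcomplex_def subspace_0)

lemma homology_deg_zero_iff:
  assumes Y: "subcomplex Y"
  shows "homology_deg_zero Y i \<longleftrightarrow> {z \<in> Y \<inter> X i. d z = 0} \<subseteq> d ` (Y \<inter> X (i + 1))"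
  unfolding homology_deg_zero_def homology_deg_def
  using Y module_hom.zero[OF d_linear] subspace_component
  by (intro quotient_eq_zero_iff subspace_boundaries subspace_inter)
    (auto simp: subcomplex_def subspace_0)

text \<open>A homogeneous cycle that bounds an arbitrary \<open>y\<close> also bounds the component
  of \<open>y\<close> one degree higher, since \<open>d\<close> commutes with components up to the
  shift.\<close>

lemma homology_zero_imp_homology_deg_zero:
  assumes Y: "subcomplex Y" and H: "homology_zero Y"
  shows "homology_deg_zero Y i"
  unfolding homology_deg_zero_iff[OF Y]
proof clarify
  fix z assume z: "z \<in> Y" "z \<in> X i" "d z = 0"
  then obtain y where y: "y \<in> Y" "z = d y" using H homology_zero_iff[OF Y] by blast
  have "z = d (component y (i + 1))"
    using component_homogeneous[OF z(2)] y(2) component_d by metis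
  then show "z \<in> d ` (Y \<inter> X (i + 1))"
    using subcomplex_component[OF Y y(1)] component_in by blast
qed

lemma minimal_homology_deg_zero:
  assumes m: "local_ring m" and Y: "subcomplex Y" and min: "minimal m Y"
    and fg: "finitely_generated (Y \<inter> X (i + 1))"
    and Yi: "Y \<inter> X i = {0}" and H: "homology_deg_zero Y (i + 1)"
  shows "Y \<inter> X (i + 1) = {0}"
proof (rule nakayama[OF m fg], rule subsetI)
  fix z assume z: "z \<in> Y \<inter> X (i + 1)"
  have "d z \<in> Y" "d z \<in> X i" using z Y d_degree[of z "i + 1"] by (auto simp: subcomplex_def)
  then have "d z = 0" using Yi by blast
  \<comment> \<open>The degree of the preimage is dropped here because minimality speaks of all of
    \<open>Y\<close>; \<open>ideal_times_homogeneous\<close> brings the degree back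
    afterwards.\<close>
  with z H have "z \<in> d ` Y" using homology_deg_zero_iff[OF Y] by blast
  with min have "z \<in> ideal_times m Y" unfolding minimal_def by blast
  with z show "z \<in> ideal_times m (Y \<inter> X (i + 1))" using ideal_times_homogeneous[OF Y] by blast
qed

end

section \<open>The associator submodule and the theorem\<close>

context mdg_module
begin

lemma subcomplex_associator_submodule: "subcomplex associator_submodule"
  using associator_submodule_smallest(1) by (simp add: mdg_submodule_def)

text \<open>If all associators vanish, \<open>{0}\<close> is an MDG submodule containing them, hence
  contains the smallest one. Conversely every associator lies in the associator submodule.\<close>

lemma associative_iff: "associative \<longleftrightarrow> associator_submodule = {0}"
proof
  assume "associative"
  then have "associator a b x \<in> {0}" for a b x by (simp add: associative_def associator_def)
  moreover have "mdg_submodule {0}"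
    using act_chain_map module_hom.zero subcomplex_zero
    unfolding mdg_submodule_def chain_pairing_def by blast
  ultimately have "associator_submodule \<subseteq> {0}" by (intro associator_submodule_smallest(3))
  then show "associator_submodule = {0}"
    using subcomplex_associator_submodule subspace_0 by (auto simp: subcomplex_def)
next
  assume "associator_submodule = {0}"
  then show "associative"
    using associator_submodule_smallest(2) by (simp add: associative_def associator_def)
qed

end

theorem theorem3p1:
  fixes m :: "'r::comm_ring_1 set"
    and scaleA :: "'r \<Rightarrow> 'a::ab_group_add \<Rightarrow> 'a"
    and A :: "int \<Rightarrow> 'a set"
    and dA :: "'a \<Rightarrow> 'a"
    and mul :: "'a \<Rightarrow> 'a \<Rightarrow> 'a"
    and unit :: 'a
    and scale :: "'r \<Rightarrow> 'x::ab_group_add \<Rightarrow> 'x"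
    and X :: "int \<Rightarrow> 'x set"
    and d :: "'x \<Rightarrow> 'x"
    and act :: "'a \<Rightarrow> 'x \<Rightarrow> 'x"
    and Y :: "'x set"
  assumes "local_ring m"
    and "mdg_algebra scaleA A dA mul unit"
    and "mdg_module scaleA A dA mul unit scale X d act"
    and "Y = mdg_module.associator_submodule mul scale X d act"
    and "R_complex.minimal scale d m Y"
    and "\<forall>i. module.finitely_generated scale (Y \<inter> X i)"
  shows "(\<forall>i. mdg_module.associative_in_degree mul scale X d act i \<longrightarrow>
            (mdg_module.associative_in_degree mul scale X d act (i + 1) \<longleftrightarrow>
             mdg_module.homologically_associative_in_degree mul scale X d act (i + 1))) \<and>
         ((\<exists>n. \<forall>i<n. Y \<inter> X i = {0}) \<longrightarrow>
            (mdg_module.associative mul act \<longleftrightarrow>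
             mdg_module.homologically_associative mul scale X d act))"
proof -
  interpret mdg_module scaleA A dA mul unit scale X d act by (rule assms(3))
  note sub = subcomplex_associator_submodule
  note eq = assms(4)
  have min: "minimal m associator_submodule"
    and fg: "finitely_generated (associator_submodule \<inter> X i)" for i
    using assms(5,6) unfolding eq by auto
  \<comment> \<open>When the submodule vanishes in a degree, its only cycle there is
    \<open>0\<close>, which must be exhibited as a boundary.\<close>
  have zero: "0 \<in> d ` (associator_submodule \<inter> X i)" for i
    using sub subspace_0[OF subspace_component, of i] module_hom.zero[OF d_linear]
    by (auto simp: subcomplex_def subspace_0 intro!: image_eqI[of _ _ 0])
  have degree_step: "associative_in_degree (i + 1) \<longleftrightarrow> homologically_associative_in_degree (i + 1)"
    if "associative_in_degree i" for i
  proof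
    assume "associative_in_degree (i + 1)"
    then have "{z \<in> associator_submodule \<inter> X (i + 1). d z = 0} \<subseteq> {0}"
      unfolding associative_in_degree_def by blast
    also have "\<dots> \<subseteq> d ` (associator_submodule \<inter> X (i + 1 + 1))" using zero by simp
    finally show "homologically_associative_in_degree (i + 1)"
      unfolding homologically_associative_in_degree_def homology_deg_zero_iff[OF sub] .
  next
    assume "homologically_associative_in_degree (i + 1)"
    with that show "associative_in_degree (i + 1)"
      unfolding associative_in_degree_def homologically_associative_in_degree_def
      by (rule minimal_homology_deg_zero[OF assms(1) sub min fg])
  qed
  moreover have "associative \<longleftrightarrow> homologically_associative"
    if n: "\<forall>i<n. Y \<inter> X i = {0}" for n
  proof
    assume "associative"
    then show "homologically_associative"
      \<comment> \<open>The submodule is \<open>{0}\<close>, whose only cycle is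
        \<open>0 = d 0\<close>.\<close>
      using module_hom.zero[OF d_linear]
      by (auto simp: associative_iff homologically_associative_def
          homology_zero_iff[OF subcomplex_zero])
  next
    assume H: "homologically_associative"
    \<comment> \<open>The induction starts at \<open>n - 1\<close>, the last degree where vanishing
      is assumed; each step climbs one degree by \<open>degree_step\<close>.\<close>
    have "associative_in_degree i" if "i \<ge> n - 1" for i
      using that
    proof (induction i rule: int_ge_induct)
      case base
      then show ?case using n by (simp add: associative_in_degree_def eq)
    next
      case (step i)
      have "homologically_associative_in_degree (i + 1)"
        using H homology_zero_imp_homology_deg_zero[OF sub]
        by (simp add: homologically_associative_def homologically_associative_in_degree_def)
      with step.IH degree_step show ?case by blast
    qed
    \<comment> \<open>Degrees below \<open>n\<close> are covered by the bound, the others by the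
      induction. A graded submodule with no nonzero component is zero.\<close>
    then have "associator_submodule \<inter> X i = {0}" for i
      using n[unfolded eq] by (cases "i < n") (auto simp: associative_in_degree_def)
    then show "associative" using subcomplex_eq_zero[OF sub] by (simp add: associative_iff)
  qed
  ultimately show ?thesis by blast
qed

end
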